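(* Let $K\subset\mathbb{R}^2$ be an origin symmetric convex body and let $S\subset\mathbb{R}^2$ be a square centered at the origin. Then $\mathcal{P}(K)\geq \mathcal{P}(S)$.
   Context: A convex body in $\mathbb{R}^2$ is a compact convex subset with non-empty interior; it is origin symmetric if $K=-K$. The polar body of a convex body $K$ containing the origin in its interior is $K^{\ast}=\{x\in\mathbb{R}^2 : x\cdot y\leq 1 \text{ for all } y\in K\}$. Write $V$ for area (2-dimensional volume). The volume-product of $K$ is $\mathcal{P}(K)=V(K)\,V(K^{\ast})$. *)

theory Defs
  imports "HOL-Analysis.Analysis"
begin

definition convex_body :: "'a::euclidean_space set \<Rightarrow> bool" where
  "convex_body K \<longleftrightarrow> compact K \<and> convex K \<and> interior K \<noteq> {}"

definition origin_symmetric :: "'a::euclidean_space set \<Rightarrow> bool" where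
  "origin_symmetric K \<longleftrightarrow> K = uminus ` K"

definition polar_body :: "'a::euclidean_space set \<Rightarrow> 'a set" where
  "polar_body K = {x. \<forall>y\<in>K. x \<bullet> y \<le> 1}"

text \<open>
  Polar bodies are only of interest when the origin is an interior point of the body. In
  particular, the volume product is then a product of two finite volumes; in general,
  \<^const>\<open>measure\<close> assigns 0 to a set of infinite volume.
\<close>
definition volume_product :: "'a::euclidean_space set \<Rightarrow> real" where
  "volume_product K = measure lebesgue K * measure lebesgue (polar_body K)"

text \<open>
  A solid square of arbitrary orientation: \<open>u\<close> and \<open>w\<close> are the vectors from the centre \<open>c\<close> to the
  midpoints of two adjacent sides, so the sides have length \<open>2 * norm u\<close>.
\<close>
definition square_centered_at :: "real ^ 2 \<Rightarrow> (real ^ 2) set \<Rightarrow> bool" where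
  "square_centered_at c S \<longleftrightarrow>
     (\<exists>u w. u \<noteq> 0 \<and> norm u = norm w \<and> orthogonal u w \<and>
        S = {c + s *\<^sub>R u + t *\<^sub>R w | s t. \<bar>s\<bar> \<le> 1 \<and> \<bar>t\<bar> \<le> 1})"

end

theory Submission
  imports Defs
begin

text \<open>
  The volume product of every square is 8, because the polar of a square is again a square. So the
  claim is that \<open>V(K) V(K\<^sup>*) \<ge> 8\<close> for every origin symmetric convex body \<open>K\<close> of the plane.

  The engine is an observation of Meyer: if a convex set contains \<open>0\<close>, \<open>u\<close>, \<open>v\<close> and a point
  \<open>a u + b v\<close> with \<open>a, b \<ge> 0\<close>, then it contains the two triangles that these points span, so that
  its part in the sector between \<open>u\<close> and \<open>v\<close> has area at least \<open>(a + b) det(u, v) / 2\<close>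
  (\<open>sector_measure_lower_bound\<close>). It is used twice, once for \<open>K\<close> and once for its polar.

  By the intermediate value theorem, two lines through the origin cut \<open>K\<close> into four pieces of
  equal area \<open>V / 4\<close>, where \<open>V = V(K)\<close> (\<open>symmetric_equipartition\<close>). Let \<open>u\<close> and \<open>v\<close> be points where
  these lines meet the boundary, and let \<open>D = det(u, v) > 0\<close>. The observation, applied to each of
  the four pieces, gives \<open>\<bar>a\<bar> + \<bar>b\<bar> \<le> V / (2 D)\<close> for all \<open>a u + b v \<in> K\<close>. This \<open>l\<^sub>1\<close> bound says
  precisely that the polar body contains the functionals \<open>y\<close> and \<open>y'\<close> that send \<open>a u + b v\<close> to
  \<open>(2 D / V) (a + b)\<close> and to \<open>(2 D / V) (b - a)\<close>.

  Finally let \<open>p\<close> and \<open>q\<close> be the functionals in the polar body that support \<open>K\<close> at \<open>u\<close> and at \<open>v\<close>.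
  By symmetry \<open>\<bar>p v\<bar> \<le> 1\<close> and \<open>\<bar>q u\<bar> \<le> 1\<close>; hence \<open>q\<close> lies in the sector between \<open>y\<close> and \<open>y'\<close>,
  and \<open>- p\<close> in the sector between \<open>y'\<close> and \<open>- y\<close>. In the bases \<open>(y, y')\<close> and \<open>(y', - y)\<close> the sum of
  their coordinates is \<open>V / (2 D)\<close>, whatever \<open>p v\<close> and \<open>q u\<close> are. As
  \<open>det(y, y') = 8 D / V\<^sup>2\<close>, the same observation shows that the polar body has area at least
  \<open>2 / V\<close> in each of the two sectors, and by symmetry area at least \<open>8 / V\<close> in total.
\<close>

section \<open>Orientation and rotation in the plane\<close>

definition cross2 :: "real ^ 2 \<Rightarrow> real ^ 2 \<Rightarrow> real" where
  "cross2 u v = u $ 1 * v $ 2 - u $ 2 * v $ 1"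

text \<open>
  If \<open>cross2 u v > 0\<close>, this is the cone of all \<open>a u + b v\<close> with \<open>a, b \<ge> 0\<close>. Unlike the cone,
  the intersection of half-planes is still a half-plane when \<open>v = - u \<noteq> 0\<close>, so that one formula
  covers all angles up to \<open>\<pi>\<close>.
\<close>
definition sector :: "real ^ 2 \<Rightarrow> real ^ 2 \<Rightarrow> (real ^ 2) set" where
  "sector u v = {x. 0 \<le> cross2 u x \<and> 0 \<le> cross2 x v}"

text \<open>
  Represents the functional \<open>cross2 u\<close> by the inner product, so that dual bases have explicit formulas.
\<close>
definition rot90 :: "real ^ 2 \<Rightarrow> real ^ 2" where
  "rot90 u = vector [- u $ 2, u $ 1]"

lemma inner_real2: "x \<bullet> y = x $ 1 * y $ 1 + x $ 2 * y $ 2" for x y :: "real ^ 2"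
  by (simp add: inner_vec_def sum_2)

lemma eq_real2_iff: "x = y \<longleftrightarrow> x $ 1 = y $ 1 \<and> x $ 2 = y $ 2" for x y :: "real ^ 2"
  by (simp add: vec_eq_iff forall_2)

lemma inner_rot90: "rot90 u \<bullet> x = cross2 u x"
  by (simp add: inner_real2 rot90_def cross2_def)

lemma cross2_rot90: "cross2 (rot90 u) (rot90 v) = cross2 u v"
  by (simp add: rot90_def cross2_def)

lemma rot90_eq_0_iff: "rot90 u = 0 \<longleftrightarrow> u = 0"
  by (auto simp: rot90_def eq_real2_iff)

text \<open>Cramer's rule, multiplied by the determinant.\<close>
lemma cross2_expansion: "cross2 u v *\<^sub>R x = cross2 x v *\<^sub>R u + cross2 u x *\<^sub>R v"
  by (simp add: eq_real2_iff cross2_def algebra_simps)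

lemma cross2_linear_simps:
  "cross2 (x + y) z = cross2 x z + cross2 y z" "cross2 z (x + y) = cross2 z x + cross2 z y"
  "cross2 (x - y) z = cross2 x z - cross2 y z" "cross2 z (x - y) = cross2 z x - cross2 z y"
  "cross2 (a *\<^sub>R x) z = a * cross2 x z" "cross2 z (a *\<^sub>R x) = a * cross2 z x"
  "cross2 (- x) z = - cross2 x z" "cross2 z (- x) = - cross2 z x"
  "cross2 x x = 0" "cross2 0 x = 0" "cross2 x 0 = 0"
  by (auto simp: cross2_def algebra_simps)

lemma cross2_commute: "cross2 u v = - cross2 v u"
  by (simp add: cross2_def)

lemma continuous_on_cross2 [continuous_intros]:
  "continuous_on A f \<Longrightarrow> continuous_on A g \<Longrightarrow> continuous_on A (\<lambda>x. cross2 (f x) (g x))"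
  unfolding cross2_def by (intro continuous_intros)

lemma tendsto_cross2 [tendsto_intros]:
  "(f \<longlongrightarrow> a) F \<Longrightarrow> (g \<longlongrightarrow> b) F \<Longrightarrow> ((\<lambda>x. cross2 (f x) (g x)) \<longlongrightarrow> cross2 a b) F"
  unfolding cross2_def by (intro tendsto_intros)

section \<open>Areas of pieces cut off by lines through the origin\<close>

lemma convex_hull_cross2_nonneg:
  assumes "\<And>y. y \<in> A \<Longrightarrow> 0 \<le> cross2 x y" "y \<in> convex hull A"
  shows "0 \<le> cross2 x y"
proof -
  have "convex {y. 0 \<le> cross2 x y}"
    using convex_halfspace_ge[of 0 "rot90 x"] by (simp add: inner_rot90)
  then have "convex hull A \<subseteq> {y. 0 \<le> cross2 x y}"
    using assms(1) by (intro hull_minimal) auto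
  then show ?thesis using assms(2) by auto
qed

lemma negligible_line:
  assumes "x \<noteq> 0" shows "negligible {y. cross2 x y = 0}"
  using negligible_hyperplane[of "rot90 x" 0] assms by (simp add: inner_rot90 rot90_eq_0_iff)

text \<open>
  Sets on opposite sides of a line overlap in a null set only. All additivity of area that the
  argument needs has this form.
\<close>
lemma measure_add_le_across_line:
  assumes "compact A" "compact B" "compact C" "A \<subseteq> C" "B \<subseteq> C" "x \<noteq> 0"
    and "\<And>y. y \<in> A \<Longrightarrow> cross2 x y \<le> 0" "\<And>y. y \<in> B \<Longrightarrow> 0 \<le> cross2 x y"
  shows "measure lebesgue A + measure lebesgue B \<le> measure lebesgue C"
proof -
  have "A \<inter> B \<subseteq> {y. cross2 x y = 0}"
    using assms(7,8) by (force intro: antisym)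
  then have "negligible (A \<inter> B)"
    using negligible_line[OF \<open>x \<noteq> 0\<close>] negligible_subset by blast
  then have 0: "measure lebesgue (A \<inter> B) = 0"
    by (rule negligible_imp_measure0)
  have "measure lebesgue A + measure lebesgue B = measure lebesgue (A \<union> B)"
    using measure_Un3[of A lebesgue B] assms(1,2) 0 by (simp add: lmeasurable_compact)
  also have "\<dots> \<le> measure lebesgue C"
    using assms by (intro measure_mono_fmeasurable) (auto simp: lmeasurable_compact fmeasurableD)
  finally show ?thesis .
qed

lemma measure_triangle_0: "measure lebesgue (convex hull {0, u, v}) = \<bar>cross2 u v\<bar> / 2"
proof -
  have "compact (convex hull {0, u, v})"
    by (intro finite_imp_compact_convex_hull) auto
  then have "measure lebesgue (convex hull {0, u, v}) = measure lborel (convex hull {0, u, v})"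
    by (intro measure_completion) (auto dest: compact_imp_closed)
  then show ?thesis
    by (simp add: content_triangle cross2_def abs_minus_commute mult.commute)
qed

lemma closed_sector: "closed (sector u v)"
  unfolding sector_def by (intro closed_Collect_conj closed_Collect_le continuous_intros)

lemma sector_scaleR:
  assumes "a > 0" "b > 0" shows "sector (a *\<^sub>R u) (b *\<^sub>R v) = sector u v"
  using assms by (auto simp: sector_def cross2_linear_simps zero_le_mult_iff)

lemma convex_sector: "convex (sector u v)"
proof -
  have "sector u v = {x. 0 \<le> rot90 u \<bullet> x} \<inter> {x. 0 \<le> rot90 (- v) \<bullet> x}"
    by (auto simp: sector_def inner_rot90 cross2_def algebra_simps)
  then show ?thesis
    by (metis convex_Int convex_halfspace_ge)
qed

text \<open>
  The triangles with vertices \<open>0, u, x\<close> and \<open>0, x, v\<close>, where \<open>x = a u + b v\<close>, lie on different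
  sides of the line through \<open>x\<close>, and their areas are \<open>b / 2\<close> and \<open>a / 2\<close> times \<open>cross2 u v\<close>. For
  \<open>a + b < 1\<close> the bound is weaker than the area of the triangle with vertices \<open>0, u, v\<close>, but it is
  linear in \<open>x\<close>, and this turns areas into statements about the polar body.
\<close>
lemma sector_measure_lower_bound:
  assumes "compact C" "convex C" "0 \<in> C" "u \<in> C" "v \<in> C" "a *\<^sub>R u + b *\<^sub>R v \<in> C"
    and "0 \<le> a" "0 \<le> b" "0 < cross2 u v"
  shows "(a + b) / 2 * cross2 u v \<le> measure lebesgue (C \<inter> sector u v)"
proof (cases "a = 0 \<and> b = 0")
  case False
  define x where "x = a *\<^sub>R u + b *\<^sub>R v"
  have ux: "cross2 u x = b * cross2 u v" and xv: "cross2 x v = a * cross2 u v"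
    by (simp_all add: x_def cross2_linear_simps)
  have "x \<noteq> 0"
    using ux xv False assms(9) by (auto simp: cross2_linear_simps)
  have mem: "{0, u, v, x} \<subseteq> C \<inter> sector u v"
    using assms ux xv by (auto simp: x_def[symmetric] sector_def cross2_linear_simps)
  have conv: "convex (C \<inter> sector u v)"
    using assms convex_sector by (intro convex_Int) auto
  have "measure lebesgue (convex hull {0, u, x}) + measure lebesgue (convex hull {0, x, v})
      \<le> measure lebesgue (C \<inter> sector u v)"
  proof (rule measure_add_le_across_line[where x = x])
    show "convex hull {0, u, x} \<subseteq> C \<inter> sector u v" "convex hull {0, x, v} \<subseteq> C \<inter> sector u v"
      using mem conv by (intro hull_minimal; blast)+
    have "0 \<le> cross2 (- x) u"
      using ux assms cross2_commute[of u x] by (simp add: cross2_linear_simps)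
    then show "cross2 x y \<le> 0" if "y \<in> convex hull {0, u, x}" for y
    proof -
      have "0 \<le> cross2 (- x) y"
        using \<open>0 \<le> cross2 (- x) u\<close>
        by (intro convex_hull_cross2_nonneg[OF _ that]) (auto simp: cross2_linear_simps)
      then show ?thesis by (simp add: cross2_linear_simps)
    qed
    have "0 \<le> cross2 x v"
      using xv assms by simp
    then show "0 \<le> cross2 x y" if "y \<in> convex hull {0, x, v}" for y
      using \<open>0 \<le> cross2 x v\<close>
      by (intro convex_hull_cross2_nonneg[OF _ that]) (auto simp: cross2_linear_simps)
    show "compact (C \<inter> sector u v)"
      using assms closed_sector by blast
  qed (use \<open>x \<noteq> 0\<close> in \<open>auto intro!: finite_imp_compact_convex_hull\<close>)
  then show ?thesis
    using assms by (simp add: measure_triangle_0 ux xv field_simps)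
qed simp

lemma measure_linear_image_real2:
  fixes u v :: "real ^ 2"
  assumes "A \<in> lmeasurable"
  shows "measure lebesgue ((\<lambda>z::real^2. z $ 1 *\<^sub>R u + z $ 2 *\<^sub>R v) ` A) = \<bar>cross2 u v\<bar> * measure lebesgue A"
proof -
  let ?f = "\<lambda>z::real^2. z $ 1 *\<^sub>R u + z $ 2 *\<^sub>R v"
  have "linear ?f"
    by (rule linearI) (auto simp: algebra_simps)
  moreover have "det (matrix ?f) = cross2 u v"
    by (simp add: det_2 matrix_def cross2_def axis_def)
  ultimately show ?thesis
    using measure_linear_image[of ?f A] assms by simp
qed

lemma measure_uminus_image:
  assumes "A \<in> lmeasurable"
  shows "measure lebesgue (uminus ` A) = measure lebesgue (A :: (real ^ 2) set)"
proof -
  have eq: "uminus = (\<lambda>z::real^2. z $ 1 *\<^sub>R vector [-1, 0] + z $ 2 *\<^sub>R vector [0, -1])"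
    by (auto simp: eq_real2_iff)
  then show ?thesis
    using measure_linear_image_real2[OF assms, of "vector [-1, 0]" "vector [0, -1]"]
    unfolding eq[symmetric] by (simp add: cross2_def)
qed

text \<open>
  The two sectors make up a half-plane, and the reflected half of \<open>C\<close> has the same area.
\<close>
lemma symmetric_sector_measures:
  assumes "compact C" "origin_symmetric C" "0 < cross2 u v"
  shows "2 * (measure lebesgue (C \<inter> sector u v) + measure lebesgue (C \<inter> sector v (- u)))
    \<le> measure lebesgue C"
proof -
  define H where "H = C \<inter> {x. 0 \<le> cross2 u x}"
  have cl: "closed {x. 0 \<le> cross2 u x}"
    by (intro closed_Collect_le continuous_intros)
  have H: "compact H"
    using assms(1) cl unfolding H_def by blast
  have uv: "u \<noteq> 0" "v \<noteq> 0"
    using assms(3) by (auto simp: cross2_linear_simps)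
  have 1: "measure lebesgue (C \<inter> sector u v) + measure lebesgue (C \<inter> sector v (- u))
      \<le> measure lebesgue H"
  proof (rule measure_add_le_across_line[where x = v])
    show "compact (C \<inter> sector u v)" "compact (C \<inter> sector v (- u))"
      using assms(1) closed_sector by blast+
    show "C \<inter> sector u v \<subseteq> H" "C \<inter> sector v (- u) \<subseteq> H"
      by (auto simp: H_def sector_def cross2_linear_simps cross2_commute[of _ u])
  qed (use H uv in \<open>auto simp: sector_def cross2_commute[of v]\<close>)
  have "measure lebesgue (uminus ` H) + measure lebesgue H \<le> measure lebesgue C"
  proof (rule measure_add_le_across_line[where x = u])
    show "compact (uminus ` H)"
      using H by (rule compact_negations)
    show "uminus ` H \<subseteq> C"
      using assms(2) by (auto simp: H_def origin_symmetric_def)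
  qed (use H uv assms(1) in \<open>auto simp: H_def cross2_linear_simps\<close>)
  then show ?thesis
    using 1 H by (simp add: measure_uminus_image lmeasurable_compact)
qed

section \<open>Equipartition by two lines\<close>

text \<open>
  When \<open>W n\<close> tends to \<open>w\<close>, a point off the line through \<open>w\<close> eventually lies on the same side of
  the line through \<open>W n\<close> as of the line through \<open>w\<close>. So the indicator functions converge almost
  everywhere, and dominated convergence applies.
\<close>
lemma isCont_measure_halfplane:
  assumes "compact C" "w \<noteq> 0"
  shows "isCont (\<lambda>w. measure lebesgue (C \<inter> {x. 0 \<le> cross2 x w})) w"
  unfolding continuous_at_sequentially
proof (intro allI impI)
  fix W :: "nat \<Rightarrow> real ^ 2" assume W: "W \<longlonglongrightarrow> w"
  let ?A = "\<lambda>w. C \<inter> {x. 0 \<le> cross2 x w}"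
  have "closed {x. 0 \<le> cross2 x w}" for w
    by (intro closed_Collect_le continuous_intros)
  then have cA: "?A w \<in> lmeasurable" for w
    using assms(1) by (intro lmeasurable_compact) blast
  have "{x. cross2 x w = 0} = {x. cross2 w x = 0}"
    by (auto simp: cross2_commute[of _ w])
  then have "{x. cross2 x w = 0} \<in> null_sets lebesgue"
    using negligible_line[OF assms(2)] by (simp add: negligible_iff_null_sets)
  then have ae: "AE x in lebesgue. cross2 x w \<noteq> 0"
    by (auto dest: AE_not_in)
  have ev: "\<forall>\<^sub>F n in sequentially. indicat_real (?A (W n)) x = indicat_real (?A w) x"
    if "cross2 x w \<noteq> 0" for x
  proof -
    have lim: "(\<lambda>n. cross2 x (W n)) \<longlonglongrightarrow> cross2 x w"
      using W by (intro tendsto_intros)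
    show ?thesis
    proof (cases "cross2 x w > 0")
      case True
      then show ?thesis
        using order_tendstoD(1)[OF lim True] by (auto elim!: eventually_mono simp: indicator_def)
    next
      case False
      then have "cross2 x w < 0" using that by auto
      then show ?thesis
        using order_tendstoD(2)[OF lim, of 0] by (auto elim!: eventually_mono simp: indicator_def)
    qed
  qed
  have "(\<lambda>n. integral\<^sup>L lebesgue (indicat_real (?A (W n))))
      \<longlonglongrightarrow> integral\<^sup>L lebesgue (indicat_real (?A w))"
  proof (rule integral_dominated_convergence[where w = "indicat_real C"])
    show "integrable lebesgue (indicat_real C)"
      using assms(1) lmeasurable_compact lmeasurable_iff_integrable by blast
    show "AE x in lebesgue. (\<lambda>n. indicat_real (?A (W n)) x) \<longlonglongrightarrow> indicat_real (?A w) x"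
      using ae by eventually_elim (intro tendsto_eventually ev)
  qed (use cA in \<open>auto simp: indicator_def\<close>)
  then show "((\<lambda>w. measure lebesgue (?A w)) \<circ> W) \<longlonglongrightarrow> measure lebesgue (?A w)"
    by (simp add: o_def)
qed

text \<open>
  Fix one line and rotate the other by an angle \<open>\<theta>\<close> from \<open>0\<close> to \<open>\<pi>\<close>. The area of \<open>C\<close> between the two
  rays increases continuously from 0 to \<open>V(C) / 2\<close> and hence takes the value \<open>V(C) / 4\<close>. The
  adjacent sector has at most the rest of the half, which is also \<open>V(C) / 4\<close>.
\<close>
lemma symmetric_equipartition:
  assumes "compact C" "origin_symmetric C" "0 < measure lebesgue C"
  obtains u v where "0 < cross2 u v"
    "measure lebesgue (C \<inter> sector u v) \<le> measure lebesgue C / 4"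
    "measure lebesgue (C \<inter> sector v (- u)) \<le> measure lebesgue C / 4"
proof -
  define e1 e2 :: "real ^ 2" where "e1 = vector [1, 0]" and "e2 = vector [0, 1]"
  define d where "d \<theta> = cos \<theta> *\<^sub>R e1 + sin \<theta> *\<^sub>R e2" for \<theta> :: real
  have cd: "cross2 e1 (d \<theta>) = sin \<theta>" for \<theta>
    by (simp add: e1_def e2_def d_def cross2_def)
  have "d \<theta> $ 1 = cos \<theta>" "d \<theta> $ 2 = sin \<theta>" for \<theta>
    by (simp_all add: e1_def e2_def d_def)
  then have d_nz: "d \<theta> \<noteq> 0" for \<theta>
    by (metis zero_index sin_cos_squared_add zero_neq_one add_0 power_zero_numeral)
  have d_cont: "isCont d \<theta>" for \<theta>
    unfolding d_def by (intro continuous_intros)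
  define H where "H = C \<inter> {x. 0 \<le> cross2 e1 x}"
  define F where "F \<theta> = measure lebesgue (H \<inter> {x. 0 \<le> cross2 x (d \<theta>)})" for \<theta>
  have F_eq: "F \<theta> = measure lebesgue (C \<inter> sector e1 (d \<theta>))" for \<theta>
    unfolding F_def H_def sector_def by (rule arg_cong[where f = "measure lebesgue"]) auto
  have "closed {x. 0 \<le> cross2 e1 x}"
    by (intro closed_Collect_le continuous_intros)
  then have H: "compact H"
    using assms(1) unfolding H_def by blast
  have "isCont F \<theta>" for \<theta>
    unfolding F_def using isCont_o2[OF d_cont isCont_measure_halfplane[OF H d_nz]] .
  then have cont: "continuous_on {0..pi} F"
    by (simp add: continuous_at_imp_continuous_on)
  have "e1 \<noteq> 0"
    by (simp add: e1_def eq_real2_iff)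
  have F0: "F 0 = 0"
  proof -
    have "H \<inter> {x. 0 \<le> cross2 x (d 0)} \<subseteq> {x. cross2 e1 x = 0}"
      by (auto simp: H_def d_def cross2_commute[of _ e1])
    then show ?thesis
      unfolding F_def using negligible_line[OF \<open>e1 \<noteq> 0\<close>] negligible_subset negligible_imp_measure0
      by blast
  qed
  have "H \<inter> {x. 0 \<le> cross2 x (d pi)} = H"
    by (auto simp: H_def d_def cross2_linear_simps cross2_commute[of _ e1])
  then have Fpi: "F pi = measure lebesgue H"
    by (simp add: F_def)
  have half: "measure lebesgue C \<le> 2 * measure lebesgue H"
  proof -
    have "x \<in> uminus ` H" if "x \<in> C" "x \<notin> H" for x
    proof (rule image_eqI[of _ _ "- x"])
      have "- x \<in> C" using that(1) assms(2) unfolding origin_symmetric_def by blast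
      then show "- x \<in> H" using that by (auto simp: H_def cross2_linear_simps)
    qed simp
    then have "C \<subseteq> H \<union> uminus ` H" by auto
    moreover have m: "H \<in> lmeasurable" "uminus ` H \<in> lmeasurable" "C \<in> lmeasurable"
      using H assms(1) by (auto intro!: lmeasurable_compact compact_negations)
    ultimately have "measure lebesgue C \<le> measure lebesgue (H \<union> uminus ` H)"
      by (intro measure_mono_fmeasurable) auto
    also have "\<dots> \<le> measure lebesgue H + measure lebesgue (uminus ` H)"
      using m by (intro measure_Un_le) auto
    finally show ?thesis using m by (simp add: measure_uminus_image)
  qed
  then obtain \<theta> where \<theta>: "0 \<le> \<theta>" "\<theta> \<le> pi" "F \<theta> = measure lebesgue C / 4"
    using IVT'[OF _ _ _ cont, of "measure lebesgue C / 4"] F0 Fpi assms(3) half by auto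
  have "\<theta> \<noteq> 0" "\<theta> \<noteq> pi"
    using \<theta> F0 Fpi assms(3) half by auto
  then have pos: "0 < cross2 e1 (d \<theta>)"
    using \<theta> by (simp add: cd sin_gt_zero)
  show thesis
    using that[OF pos] symmetric_sector_measures[OF assms(1,2) pos] \<theta>(3) by (simp add: F_eq)
qed

section \<open>Polar bodies\<close>

lemma interior_0_of_symmetric_convex_body:
  assumes "convex_body K" "origin_symmetric K"
  shows "0 \<in> interior K"
proof -
  obtain x where x: "x \<in> interior K"
    using assms(1) by (auto simp: convex_body_def)
  then have "- x \<in> uminus ` interior K" by blast
  also have "uminus ` interior K = interior K"
    using assms(2) by (metis interior_negations origin_symmetric_def)
  finally have "(1/2) *\<^sub>R x + (1/2) *\<^sub>R (- x) \<in> interior K"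
    using x assms(1) by (intro convexD convex_interior) (auto simp: convex_body_def)
  then show ?thesis by simp
qed

lemma polar_body_eq_Inter: "polar_body K = (\<Inter>y\<in>K. {x. y \<bullet> x \<le> 1})"
  by (auto simp: polar_body_def inner_commute)

lemma convex_polar_body: "convex (polar_body K)"
  unfolding polar_body_eq_Inter by (intro convex_INT convex_halfspace_le)

lemma zero_in_polar_body: "0 \<in> polar_body K"
  by (simp add: polar_body_def)

lemma origin_symmetric_polar_body:
  assumes "origin_symmetric K" shows "origin_symmetric (polar_body K)"
proof -
  have "- x \<in> polar_body K" if "x \<in> polar_body K" for x
    unfolding polar_body_def
  proof safe
    fix y assume "y \<in> K"
    then have "- y \<in> K" using assms unfolding origin_symmetric_def by blast
    then have "x \<bullet> (- y) \<le> 1" using that unfolding polar_body_def by blast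
    then show "- x \<bullet> y \<le> 1" by simp
  qed
  then show ?thesis
    unfolding origin_symmetric_def by (metis image_eqI minus_minus subsetI subset_antisym image_subsetI)
qed

lemma compact_polar_body:
  assumes "0 \<in> interior K" shows "compact (polar_body K)"
proof -
  obtain e where e: "e > 0" "cball 0 e \<subseteq> K"
    using assms by (meson mem_interior_cball)
  have "norm x \<le> 1 / e" if x: "x \<in> polar_body K" for x
  proof (cases "x = 0")
    case False
    have "(e / norm x) *\<^sub>R x \<in> K"
      using e False by (intro subsetD[OF e(2)]) auto
    then have "x \<bullet> ((e / norm x) *\<^sub>R x) \<le> 1"
      using x unfolding polar_body_def by blast
    then have "e * norm x \<le> 1"
      using False by (simp add: dot_square_norm power2_eq_square)
    then show ?thesis using e(1) by (simp add: field_simps)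
  qed (use e in auto)
  then have "bounded (polar_body K)"
    by (auto intro: boundedI)
  moreover have "closed (polar_body K)"
    unfolding polar_body_eq_Inter by (intro closed_INT ballI closed_halfspace_le)
  ultimately show ?thesis by (simp add: compact_eq_bounded_closed)
qed

text \<open>
  At the point where the ray leaves \<open>K\<close> there is a supporting line. It misses the origin, which is
  an interior point, and can therefore be written as \<open>p \<bullet> x = 1\<close>; that it supports \<open>K\<close> then says
  that \<open>p\<close> lies in the polar body.
\<close>
lemma boundary_point_with_polar_support:
  assumes "compact K" "convex K" "0 \<in> interior K" "l \<noteq> 0"
  obtains r p where "0 < r" "r *\<^sub>R l \<in> K" "p \<in> polar_body K" "p \<bullet> (r *\<^sub>R l) = 1"
proof -
  obtain r where r: "0 < r" "0 + r *\<^sub>R l \<in> frontier K"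
    using ray_to_frontier[of K 0 l] assms compact_imp_bounded by blast
  let ?x = "r *\<^sub>R l"
  have x: "?x \<in> K" "?x \<notin> interior K"
    using r assms(1) by (auto simp: frontier_def compact_imp_closed)
  have ri: "rel_interior K = interior K"
    using assms(3) by (intro rel_interior_nonempty_interior) auto
  obtain a where a: "\<And>y. y \<in> closure K \<Longrightarrow> a \<bullet> ?x \<le> a \<bullet> y"
      "\<And>y. y \<in> rel_interior K \<Longrightarrow> a \<bullet> ?x < a \<bullet> y"
    by (rule supporting_hyperplane_relative_frontier[of K ?x])
      (use assms(2) x ri closure_subset in auto)
  (* The functional a attains its minimum over K at ?x; the interior point 0 makes it negative. *)
  define m where "m = - (a \<bullet> ?x)"
  have "m > 0"
    using a(2)[of 0] assms(3) ri by (simp add: m_def)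
  show thesis
  proof (rule that[OF r(1) x(1), of "(- 1 / m) *\<^sub>R a"])
    show "(- 1 / m) *\<^sub>R a \<bullet> ?x = 1"
      using \<open>m > 0\<close> by (auto simp: m_def)
    have "- m \<le> a \<bullet> y" if "y \<in> K" for y
      using a(1)[of y] that closure_subset by (auto simp: m_def)
    then show "(- 1 / m) *\<^sub>R a \<in> polar_body K"
      using \<open>m > 0\<close> by (auto simp: polar_body_def field_simps)
  qed
qed

section \<open>The lower bound for symmetric bodies\<close>

text \<open>
  Mahler's inequality in the plane. Sectors do not change when their bounding vectors are scaled,
  so the equipartition may be expressed by the boundary points \<open>u\<close> and \<open>v\<close>.
\<close>
theorem volume_product_ge_8:
  assumes K: "convex_body K" and sym: "origin_symmetric (K :: (real ^ 2) set)"
  shows "8 \<le> volume_product K"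
proof -
  define V where "V = measure lebesgue K"
  let ?P = "polar_body K"
  have cK: "compact K" "convex K" and iK: "interior K \<noteq> {}"
    using K by (auto simp: convex_body_def)
  have 0: "0 \<in> interior K"
    by (rule interior_0_of_symmetric_convex_body[OF K sym])
  then have "0 \<in> K"
    using interior_subset by blast
  have minus: "- x \<in> K" if "x \<in> K" for x
    using that sym unfolding origin_symmetric_def by blast
  have cP: "compact ?P"
    by (rule compact_polar_body[OF 0])
  have symP: "origin_symmetric ?P"
    by (rule origin_symmetric_polar_body[OF sym])
  have minusP: "- x \<in> ?P" if "x \<in> ?P" for x
    using that symP unfolding origin_symmetric_def by blast
  have "\<not> negligible K"
    using negligible_convex_interior[OF cK(2)] iK by simp
  then have "V > 0"
    using cK(1) lmeasurable_compact negligible_iff_measure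
    by (metis V_def less_eq_real_def measure_nonneg)
  then obtain u0 v0 where uv0: "0 < cross2 u0 v0"
      "measure lebesgue (K \<inter> sector u0 v0) \<le> V / 4"
      "measure lebesgue (K \<inter> sector v0 (- u0)) \<le> V / 4"
    using symmetric_equipartition[OF cK(1) sym] unfolding V_def by blast
  have "u0 \<noteq> 0" "v0 \<noteq> 0"
    using uv0(1) by (auto simp: cross2_linear_simps)
  then obtain r p t q where rp: "0 < r" "r *\<^sub>R u0 \<in> K" "p \<in> ?P" "p \<bullet> (r *\<^sub>R u0) = 1"
    and tq: "0 < t" "t *\<^sub>R v0 \<in> K" "q \<in> ?P" "q \<bullet> (t *\<^sub>R v0) = 1"
    using boundary_point_with_polar_support[OF cK 0] by metis
  define u v where "u = r *\<^sub>R u0" and "v = t *\<^sub>R v0"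
  define D where "D = cross2 u v"
  have uK: "u \<in> K" and vK: "v \<in> K"
    using rp tq by (auto simp: u_def v_def)
  have "D > 0"
    using uv0(1) rp(1) tq(1) by (simp add: D_def u_def v_def cross2_linear_simps)
  have S: "measure lebesgue (K \<inter> sector u v) \<le> V / 4"
      "measure lebesgue (K \<inter> sector v (- u)) \<le> V / 4"
    using uv0(2,3) sector_scaleR[OF rp(1) tq(1), of u0 v0] sector_scaleR[OF tq(1) rp(1), of v0 "- u0"]
    by (simp_all add: u_def v_def)
  have sum_le: "2 * (a + b) * D \<le> V" if "0 \<le> a" "0 \<le> b" "a *\<^sub>R u + b *\<^sub>R v \<in> K" for a b
    using sector_measure_lower_bound[OF cK \<open>0 \<in> K\<close> uK vK that(3,1,2)] S(1) \<open>D > 0\<close>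
    by (simp add: D_def field_simps)
  have diff_le: "2 * (a + b) * D \<le> V" if "0 \<le> a" "0 \<le> b" "a *\<^sub>R v + b *\<^sub>R (- u) \<in> K" for a b
    using sector_measure_lower_bound[OF cK \<open>0 \<in> K\<close> vK minus[OF uK] that(3,1,2)] S(2) \<open>D > 0\<close>
      cross2_commute[of v u]
    by (simp add: D_def field_simps cross2_linear_simps)
  (* x = a u + b v with a = cross2 x v / D and b = cross2 u x / D. Depending on the signs of a and b,
     x or - x lies in one of the two sectors. *)
  have l1: "2 * (\<bar>cross2 x v\<bar> + \<bar>cross2 u x\<bar>) \<le> V" if "x \<in> K" for x
  proof -
    define a b where "a = cross2 x v / D" and "b = cross2 u x / D"
    have "x = (1 / D) *\<^sub>R (cross2 u v *\<^sub>R x)"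
      using \<open>D > 0\<close> by (simp add: D_def)
    also have "\<dots> = a *\<^sub>R u + b *\<^sub>R v"
      by (subst cross2_expansion) (simp add: a_def b_def scaleR_add_right)
    finally have x: "x = a *\<^sub>R u + b *\<^sub>R v" .
    have "2 * (\<bar>a\<bar> + \<bar>b\<bar>) * D \<le> V"
      using sum_le[of a b] sum_le[of "- a" "- b"] diff_le[of b "- a"] diff_le[of "- b" a]
        that minus[OF that] unfolding x
      by (cases "0 \<le> a"; cases "0 \<le> b") (auto simp: algebra_simps)
    moreover have "\<bar>a\<bar> * D = \<bar>cross2 x v\<bar>" "\<bar>b\<bar> * D = \<bar>cross2 u x\<bar>"
      using \<open>D > 0\<close> by (simp_all add: a_def b_def)
    ultimately show ?thesis
      by (simp add: algebra_simps)
  qed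
  (* The functionals a u + b v |-> (2 D / V) (a + b) and a u + b v |-> (2 D / V) (b - a). *)
  define y where "y = (2 / V) *\<^sub>R rot90 (u - v)"
  define y' where "y' = (2 / V) *\<^sub>R rot90 (u + v)"
  have "y \<in> ?P" "y' \<in> ?P"
    using l1 \<open>V > 0\<close> cross2_commute[of v]
    by (fastforce simp: polar_body_def y_def y'_def inner_rot90 cross2_linear_simps field_simps)+
  have X: "cross2 y y' = 8 * D / V\<^sup>2"
    by (simp add: y_def y'_def cross2_linear_simps cross2_rot90 D_def cross2_commute[of v u]
        power2_eq_square)
  have X': "cross2 y' (- y) = 8 * D / V\<^sup>2"
    using X cross2_commute[of y' y] by (simp add: cross2_linear_simps)
  have Xpos: "8 * D / V\<^sup>2 > 0"
    using \<open>D > 0\<close> \<open>V > 0\<close> by simp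
  (* The basis dual to (u, v) is (- rot90 v / D, rot90 u / D). *)
  have dual: "D *\<^sub>R x = (x \<bullet> v) *\<^sub>R rot90 u - (x \<bullet> u) *\<^sub>R rot90 v" for x
    by (simp add: D_def rot90_def cross2_def inner_real2 eq_real2_iff algebra_simps)
  (* Solving the definitions of y and y' for the dual basis brings in this factor. *)
  define \<kappa> where "\<kappa> = V / (4 * D)"
  have "\<kappa> > 0"
    using \<open>V > 0\<close> \<open>D > 0\<close> by (simp add: \<kappa>_def)
  have dual': "x = (\<kappa> * (x \<bullet> v + x \<bullet> u)) *\<^sub>R y + (\<kappa> * (x \<bullet> v - x \<bullet> u)) *\<^sub>R y'" for x
  proof -
    have rot: "rot90 (u - v) = rot90 u - rot90 v" "rot90 (u + v) = rot90 u + rot90 v"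
      by (simp_all add: rot90_def eq_real2_iff)
    have *: "(\<kappa> * (a + b)) *\<^sub>R ((2 / V) *\<^sub>R (f - g)) + (\<kappa> * (a - b)) *\<^sub>R ((2 / V) *\<^sub>R (f + g))
        = (1 / D) *\<^sub>R (a *\<^sub>R f - b *\<^sub>R g)" for a b and f g :: "real ^ 2"
      using \<open>V > 0\<close> \<open>D > 0\<close> by (simp add: \<kappa>_def eq_real2_iff field_simps)
    show ?thesis
      unfolding y_def y'_def rot * dual[symmetric] using \<open>D > 0\<close> by simp
  qed
  define s where "s = p \<bullet> v"
  have s: "\<bar>s\<bar> \<le> 1" "\<bar>q \<bullet> u\<bar> \<le> 1"
    using rp(3) tq(3) uK vK minus[OF uK] minus[OF vK] unfolding polar_body_def s_def
    by (fastforce simp: abs_le_iff)+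
  have pq: "p \<bullet> u = 1" "q \<bullet> v = 1"
    using rp tq by (simp_all add: u_def v_def)
  have B1: "2 / V \<le> measure lebesgue (?P \<inter> sector y y')"
  proof -
    have "(\<kappa> * (1 + q \<bullet> u) + \<kappa> * (1 - q \<bullet> u)) / 2 * cross2 y y'
        \<le> measure lebesgue (?P \<inter> sector y y')"
      using s \<open>\<kappa> > 0\<close> dual'[of q] pq tq(3) X Xpos
      by (intro sector_measure_lower_bound cP convex_polar_body zero_in_polar_body
          \<open>y \<in> ?P\<close> \<open>y' \<in> ?P\<close>) auto
    then show ?thesis
      using \<open>V > 0\<close> \<open>D > 0\<close> by (simp add: X \<kappa>_def field_simps power2_eq_square)
  qed
  have B2: "2 / V \<le> measure lebesgue (?P \<inter> sector y' (- y))"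
  proof -
    (* The counterclockwise order is y, q, y', - p, - y; so p itself is in the opposite sector. *)
    have "- p = (\<kappa> * (1 - s)) *\<^sub>R y' + (\<kappa> * (1 + s)) *\<^sub>R (- y)"
      by (subst dual'[of p]) (simp add: pq s_def algebra_simps)
    then have "(\<kappa> * (1 - s) + \<kappa> * (1 + s)) / 2 * cross2 y' (- y)
        \<le> measure lebesgue (?P \<inter> sector y' (- y))"
      using s \<open>\<kappa> > 0\<close> minusP[OF rp(3)] X' Xpos
      by (intro sector_measure_lower_bound cP convex_polar_body zero_in_polar_body
          \<open>y' \<in> ?P\<close> minusP[OF \<open>y \<in> ?P\<close>]) auto
    then show ?thesis
      using \<open>V > 0\<close> \<open>D > 0\<close> by (simp add: X' \<kappa>_def field_simps power2_eq_square)
  qed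
  have "8 / V \<le> measure lebesgue ?P"
    using symmetric_sector_measures[OF cP symP, of y y'] X Xpos B1 B2 by simp
  then show ?thesis
    using \<open>V > 0\<close> by (simp add: volume_product_def V_def field_simps)
qed

section \<open>The volume product of a square\<close>

definition parallelogram :: "real ^ 2 \<Rightarrow> real ^ 2 \<Rightarrow> (real ^ 2) set" where
  "parallelogram u w = {s *\<^sub>R u + t *\<^sub>R w | s t. \<bar>s\<bar> \<le> 1 \<and> \<bar>t\<bar> \<le> 1}"

lemma measure_parallelogram: "measure lebesgue (parallelogram u w) = 4 * \<bar>cross2 u w\<bar>"
proof -
  let ?Q = "cbox (vector [-1, -1]) (vector [1, 1]) :: (real ^ 2) set"
  have mem: "z \<in> ?Q \<longleftrightarrow> \<bar>z $ 1\<bar> \<le> 1 \<and> \<bar>z $ 2\<bar> \<le> 1" for z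
    by (auto simp: mem_box_cart forall_2 abs_le_iff)
  have "parallelogram u w = (\<lambda>z::real^2. z $ 1 *\<^sub>R u + z $ 2 *\<^sub>R w) ` ?Q"
  proof -
    have "s *\<^sub>R u + t *\<^sub>R w \<in> (\<lambda>z::real^2. z $ 1 *\<^sub>R u + z $ 2 *\<^sub>R w) ` ?Q"
      if "\<bar>s\<bar> \<le> 1" "\<bar>t\<bar> \<le> 1" for s t
      using that by (intro image_eqI[of _ _ "vector [s, t]"]) (auto simp: mem)
    then show ?thesis
      by (fastforce simp: parallelogram_def mem)
  qed
  moreover have "measure lebesgue ?Q = 4"
  proof -
    have "?Q \<noteq> {}"
      using mem[of 0] by auto
    then show ?thesis
      by (simp add: content_cbox_cart UNIV_2)
  qed
  ultimately show ?thesis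
    by (simp add: measure_linear_image_real2)
qed

text \<open>
  In the plane, \<open>w\<close> can only be \<open>rot90 u\<close> or \<open>- rot90 u\<close>.
\<close>
lemma orthogonal_frame_real2:
  fixes u w :: "real ^ 2"
  assumes "u \<noteq> 0" "norm u = norm w" "orthogonal u w"
  shows "\<bar>cross2 u w\<bar> = (norm u)\<^sup>2"
    and " (norm u)\<^sup>2 *\<^sub>R x = (x \<bullet> u) *\<^sub>R u + (x \<bullet> w) *\<^sub>R w"
proof -
  define n where "n = (norm u)\<^sup>2"
  have n: "n > 0" "u \<bullet> u = n" "w \<bullet> w = n" "u \<bullet> w = 0"
    using assms by (auto simp: n_def power2_norm_eq_inner[symmetric] orthogonal_def)
  have "(cross2 u w)\<^sup>2 + (u \<bullet> w)\<^sup>2 = (u \<bullet> u) * (w \<bullet> w)"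
    by (simp add: cross2_def inner_real2 power2_eq_square algebra_simps)
  then have sq: "(cross2 u w)\<^sup>2 = n\<^sup>2"
    using n by (simp add: power2_eq_square)
  (* w = e *\<^sub>R rot90 u with a sign e. *)
  define e where "e = cross2 u w / n"
  have e: "e\<^sup>2 = 1"
    using sq n by (simp add: e_def power_divide)
  have "(u \<bullet> u) *\<^sub>R w = (u \<bullet> w) *\<^sub>R u + cross2 u w *\<^sub>R rot90 u"
    by (simp add: eq_real2_iff rot90_def cross2_def inner_real2 algebra_simps)
  then have "n *\<^sub>R w = n *\<^sub>R (e *\<^sub>R rot90 u)"
    using n by (simp add: e_def)
  then have w: "w = e *\<^sub>R rot90 u"
    using n by (metis less_irrefl scaleR_left_imp_eq)
  have "n *\<^sub>R x = (x \<bullet> u) *\<^sub>R u + (x \<bullet> w) *\<^sub>R w" for x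
  proof -
    have "(x \<bullet> w) *\<^sub>R w = (x \<bullet> rot90 u) *\<^sub>R rot90 u"
      using e by (simp add: w power2_eq_square)
    then show ?thesis
      unfolding n(2)[symmetric]
      by (simp add: eq_real2_iff rot90_def inner_real2 algebra_simps)
  qed
  then show "(norm u)\<^sup>2 *\<^sub>R x = (x \<bullet> u) *\<^sub>R u + (x \<bullet> w) *\<^sub>R w"
    unfolding n_def .
  show "\<bar>cross2 u w\<bar> = (norm u)\<^sup>2"
    using sq n(1) unfolding n_def by (metis abs_of_pos power2_eq_iff abs_minus)
qed

text \<open>
  The polar of the square is \<open>\<bar>x \<bullet> u\<bar> + \<bar>x \<bullet> w\<bar> \<le> 1\<close>, and this \<open>l\<^sub>1\<close> ball is a square with its sides
  at 45 degrees to those of the first: \<open>\<bar>a\<bar> + \<bar>b\<bar> \<le> 1\<close> holds if and only if \<open>\<bar>a + b\<bar> \<le> 1\<close> and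
  \<open>\<bar>a - b\<bar> \<le> 1\<close>.
\<close>
lemma polar_body_square:
  assumes "u \<noteq> 0" "norm u = norm w" "orthogonal u w"
  defines "c \<equiv> 1 / (2 * (norm u)\<^sup>2)"
  shows "polar_body (parallelogram u w) = parallelogram (c *\<^sub>R (u + w)) (c *\<^sub>R (u - w))"
proof -
  have n: "u \<bullet> u * c = 1 / 2" "w \<bullet> w * c = 1 / 2" "u \<bullet> w = 0"
    using assms by (auto simp: c_def power2_norm_eq_inner[symmetric] orthogonal_def)
  have expand: "x = (x \<bullet> u + x \<bullet> w) *\<^sub>R (c *\<^sub>R (u + w)) + (x \<bullet> u - x \<bullet> w) *\<^sub>R (c *\<^sub>R (u - w))" for x
  proof -
    have "x = (2 * c) *\<^sub>R ((norm u)\<^sup>2 *\<^sub>R x)"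
      using assms(1) by (simp add: c_def)
    also have "\<dots> = (2 * c) *\<^sub>R ((x \<bullet> u) *\<^sub>R u + (x \<bullet> w) *\<^sub>R w)"
      by (simp only: orthogonal_frame_real2(2)[OF assms(1-3), of x])
    finally show ?thesis
      by (simp add: eq_real2_iff algebra_simps)
  qed
  have "x \<in> polar_body (parallelogram u w) \<longleftrightarrow> \<bar>x \<bullet> u + x \<bullet> w\<bar> \<le> 1 \<and> \<bar>x \<bullet> u - x \<bullet> w\<bar> \<le> 1" for x
  proof
    assume x: "x \<in> polar_body (parallelogram u w)"
    have "s * (x \<bullet> u) + t * (x \<bullet> w) \<le> 1" if "\<bar>s\<bar> \<le> 1" "\<bar>t\<bar> \<le> 1" for s t
    proof -
      have "s *\<^sub>R u + t *\<^sub>R w \<in> parallelogram u w"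
        using that by (auto simp: parallelogram_def)
      then have "x \<bullet> (s *\<^sub>R u + t *\<^sub>R w) \<le> 1"
        using x unfolding polar_body_def by blast
      then show ?thesis by (simp add: inner_add_right)
    qed
    from this[of 1 1] this[of 1 "-1"] this[of "-1" 1] this[of "-1" "-1"]
    show "\<bar>x \<bullet> u + x \<bullet> w\<bar> \<le> 1 \<and> \<bar>x \<bullet> u - x \<bullet> w\<bar> \<le> 1" by auto
  next
    assume x: "\<bar>x \<bullet> u + x \<bullet> w\<bar> \<le> 1 \<and> \<bar>x \<bullet> u - x \<bullet> w\<bar> \<le> 1"
    have "x \<bullet> (s *\<^sub>R u + t *\<^sub>R w) \<le> 1" if "\<bar>s\<bar> \<le> 1" "\<bar>t\<bar> \<le> 1" for s t
    proof -
      have "k * a \<le> \<bar>a\<bar>" if "\<bar>k\<bar> \<le> 1" for k a :: real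
        using mult_left_le_one_le[of "\<bar>a\<bar>" "\<bar>k\<bar>"] abs_ge_self[of "k * a"] that
        by (simp add: abs_mult)
      from this[OF that(1), of "x \<bullet> u"] this[OF that(2), of "x \<bullet> w"]
      show ?thesis
        using x unfolding inner_add_right inner_scaleR_right by linarith
    qed
    then show "x \<in> polar_body (parallelogram u w)"
      by (auto simp: polar_body_def parallelogram_def)
  qed
  moreover have "x \<in> parallelogram (c *\<^sub>R (u + w)) (c *\<^sub>R (u - w))
      \<longleftrightarrow> \<bar>x \<bullet> u + x \<bullet> w\<bar> \<le> 1 \<and> \<bar>x \<bullet> u - x \<bullet> w\<bar> \<le> 1" for x
  proof
    assume "x \<in> parallelogram (c *\<^sub>R (u + w)) (c *\<^sub>R (u - w))"
    then obtain s t where st: "\<bar>s\<bar> \<le> 1" "\<bar>t\<bar> \<le> 1"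
      and x: "x = s *\<^sub>R (c *\<^sub>R (u + w)) + t *\<^sub>R (c *\<^sub>R (u - w))"
      by (auto simp: parallelogram_def)
    have "x \<bullet> u = s * (u \<bullet> u * c) + t * (u \<bullet> u * c)" "x \<bullet> w = s * (w \<bullet> w * c) - t * (w \<bullet> w * c)"
      by (simp_all add: x inner_add_left inner_diff_left inner_commute[of w u] n(3) algebra_simps)
    then show "\<bar>x \<bullet> u + x \<bullet> w\<bar> \<le> 1 \<and> \<bar>x \<bullet> u - x \<bullet> w\<bar> \<le> 1"
      using st unfolding n(1,2) by (simp add: abs_le_iff)
  next
    assume "\<bar>x \<bullet> u + x \<bullet> w\<bar> \<le> 1 \<and> \<bar>x \<bullet> u - x \<bullet> w\<bar> \<le> 1"
    then show "x \<in> parallelogram (c *\<^sub>R (u + w)) (c *\<^sub>R (u - w))"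
      using expand[of x] unfolding parallelogram_def by blast
  qed
  ultimately show ?thesis by blast
qed

lemma volume_product_square:
  assumes "u \<noteq> 0" "norm u = norm w" "orthogonal u w"
  shows "volume_product (parallelogram u w) = 8"
proof -
  have cr: "\<bar>cross2 u w\<bar> = (norm u)\<^sup>2"
    by (rule orthogonal_frame_real2(1)[OF assms])
  have "cross2 (c *\<^sub>R (u + w)) (c *\<^sub>R (u - w)) = - (2 * c\<^sup>2) * cross2 u w" for c
    by (simp add: cross2_linear_simps cross2_commute[of w u] power2_eq_square)
  then show ?thesis
    using assms(1) by (simp add: volume_product_def polar_body_square[OF assms] measure_parallelogram
        abs_mult cr power2_eq_square)
qed

theorem theorem3p6:
  fixes K S :: "(real ^ 2) set"
  assumes "convex_body K" and "origin_symmetric K"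
    and "square_centered_at 0 S"
  shows "volume_product K \<ge> volume_product S"
proof -
  obtain u w where "u \<noteq> 0" "norm u = norm w" "orthogonal u w" "S = parallelogram u w"
    using assms(3) by (auto simp: square_centered_at_def parallelogram_def)
  then have "volume_product S = 8"
    by (simp add: volume_product_square)
  then show ?thesis
    using volume_product_ge_8[OF assms(1,2)] by simp
qed

end
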